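(* Let $\alpha,\beta\in\mathbb{R}$. Define $w_{\alpha,\beta}:\mathbb{N}\to\mathbb{R}$ by $$w_{\alpha,\beta}(n) := n^\alpha\left[1+\left(1+\frac1n\right)^\alpha-\left(1-\frac1n\right)^\beta-\left(1+\frac1n\right)^{\alpha+\beta}\right]\quad\text{for } n\ge 2,$$ and $w_{\alpha,\beta}(1):=1+2^\alpha-2^{\alpha+\beta}$. Then for every $u\in C_c(\mathbb{N}_0)$ with $u(0)=0$, $$\sum_{n=1}^\infty |u(n)-u(n-1)|^2 n^\alpha\ \ge\ \sum_{n=1}^\infty w_{\alpha,\beta}(n)\,|u(n)|^2 .$$
   Context: $\mathbb{N}=\{1,2,3,\dots\}$, $\mathbb{N}_0=\{0,1,2,\dots\}$. $C_c(\mathbb{N}_0)$ is the space of finitely supported real-valued functions on $\mathbb{N}_0$. *)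

theory Defs
  imports "HOL-Analysis.Infinite_Sum"
begin

text \<open>The weight lives on the positive integers; its value at \<open>n = 0\<close> is never used.\<close>

definition hardy_weight :: "real \<Rightarrow> real \<Rightarrow> nat \<Rightarrow> real" where
  "hardy_weight \<alpha> \<beta> n =
     (if n = 1 then 1 + 2 powr \<alpha> - 2 powr (\<alpha> + \<beta>)
      else real n powr \<alpha> *
        (1 + (1 + 1 / real n) powr \<alpha> - (1 - 1 / real n) powr \<beta>
           - (1 + 1 / real n) powr (\<alpha> + \<beta>)))"

definition finitely_supported :: "(nat \<Rightarrow> real) \<Rightarrow> bool" where
  "finitely_supported u \<longleftrightarrow> finite {n. u n \<noteq> 0}"

end

theory Submission
  imports Defs
begin

text \<open>
  The inequality comes from the trial function \<open>v n = n powr \<beta>\<close> on the positive integers,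
  extended by \<open>v 0 = 0\<close>. On the edge between \<open>n - 1\<close> and \<open>n\<close>, for \<open>n \<ge> 2\<close>, the cross term of
  \<open>(u n - u (n - 1))\<^sup>2\<close> is estimated by weighted AM--GM, the weights being the ratio
  \<open>p = v (n - 1) / v n\<close> and its inverse: the edge energy is at least
  \<open>(1 - p) (u n)\<^sup>2 + (1 - 1 / p) (u (n - 1))\<^sup>2\<close> (lemma \<open>square_diff_ge_weighted\<close>).
  The first edge has energy \<open>(u 1)\<^sup>2\<close>, which is the case \<open>p = 0\<close> of this bound because \<open>u 0 = 0\<close>.

  Multiplying by the edge weight \<open>n powr \<alpha>\<close>, summing, and collecting at each vertex \<open>n\<close> the two
  contributions of its adjacent edges gives the coefficient
  \<open>n powr \<alpha> * (1 - v (n - 1) / v n) + (n + 1) powr \<alpha> * (1 - v (n + 1) / v n)\<close>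
  of \<open>(u n)\<^sup>2\<close>. This is exactly the Hardy weight (lemma \<open>hardy_weight_eq_edge_shares\<close>). The finite
  support of \<open>u\<close> and \<open>u 0 = 0\<close> remove the boundary terms of this rearrangement.
\<close>

text \<open>The difference of the two sides is \<open>p * (a - q * b)\<^sup>2\<close>.\<close>

lemma square_diff_ge_weighted:
  fixes a b p q :: real
  assumes "p > 0" and "p * q = 1"
  shows "(1 - p) * a\<^sup>2 + (1 - q) * b\<^sup>2 \<le> (a - b)\<^sup>2"
proof -
  have "p * (a - q * b)\<^sup>2 = p * a\<^sup>2 - 2 * (p * q) * a * b + (p * q) * q * b\<^sup>2"
    by (simp add: power2_eq_square algebra_simps)
  then have "(a - b)\<^sup>2 - ((1 - p) * a\<^sup>2 + (1 - q) * b\<^sup>2) = p * (a - q * b)\<^sup>2"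
    using assms(2) by (simp add: power2_eq_square algebra_simps)
  moreover have "p * (a - q * b)\<^sup>2 \<ge> 0"
    using assms(1) by simp
  ultimately show ?thesis by linarith
qed

text \<open>
  The first summand is what the vertex \<open>n\<close> receives from the edge to \<open>n - 1\<close>, the second what it
  receives from the edge to \<open>n + 1\<close>. The separate value of the weight at \<open>1\<close> fits this formula since
  \<open>0 powr \<beta> = 0\<close> for every \<open>\<beta>\<close>, matching \<open>v 0 = 0\<close>.
\<close>

lemma hardy_weight_eq_edge_shares:
  assumes "n \<ge> 1"
  shows "hardy_weight \<alpha> \<beta> n =
    real n powr \<alpha> * (1 - (1 - 1 / real n) powr \<beta>)
      + real (Suc n) powr \<alpha> * (1 - (1 + 1 / real n) powr \<beta>)"
proof -
  have "real (Suc n) = real n * (1 + 1 / real n)"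
    using assms by (simp add: field_simps)
  then have "real (Suc n) powr \<alpha> = real n powr \<alpha> * (1 + 1 / real n) powr \<alpha>"
    by (simp add: powr_mult)
  then show ?thesis
    by (cases "n = 1") (simp_all add: hardy_weight_def powr_add algebra_simps)
qed

text \<open>
  The estimate on the edge from \<open>n\<close> to \<open>n + 1\<close>. For \<open>n = 0\<close> the hypothesis \<open>u 0 = 0\<close> makes it an
  equality, as both \<open>1 - 1 / real (Suc 0)\<close> and its power are \<open>0\<close>.
\<close>

lemma edge_energy_ge_shares:
  fixes u :: "nat \<Rightarrow> real"
  assumes "u 0 = 0"
  shows "real (Suc n) powr \<alpha> * (1 - (1 - 1 / real (Suc n)) powr \<beta>) * (u (Suc n))\<^sup>2
      + real (Suc n) powr \<alpha> * (1 - (1 + 1 / real n) powr \<beta>) * (u n)\<^sup>2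
    \<le> (u (Suc n) - u n)\<^sup>2 * real (Suc n) powr \<alpha>"
proof (cases "n = 0")
  case True
  then show ?thesis using assms by simp
next
  case False
  let ?p = "(1 - 1 / real (Suc n)) powr \<beta>" and ?q = "(1 + 1 / real n) powr \<beta>"
  have "1 - 1 / real (Suc n) > 0"
    using False by (simp add: field_simps)
  then have "?p > 0" by simp
  moreover have "(1 - 1 / real (Suc n)) * (1 + 1 / real n) = 1"
    using False by (simp add: divide_simps)
  then have "?p * ?q = 1"
    by (simp flip: powr_mult)
  ultimately have "(1 - ?p) * (u (Suc n))\<^sup>2 + (1 - ?q) * (u n)\<^sup>2 \<le> (u (Suc n) - u n)\<^sup>2"
    by (rule square_diff_ge_weighted)
  then have "((1 - ?p) * (u (Suc n))\<^sup>2 + (1 - ?q) * (u n)\<^sup>2) * real (Suc n) powr \<alpha>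
      \<le> (u (Suc n) - u n)\<^sup>2 * real (Suc n) powr \<alpha>"
    by (rule mult_right_mono) simp
  then show ?thesis by (simp only: algebra_simps)
qed

lemma infsum_from_one_eq_sum:
  fixes f :: "nat \<Rightarrow> real"
  assumes "\<And>n. n > N \<Longrightarrow> f n = 0"
  shows "(\<Sum>\<^sub>\<infinity>n\<in>{1..}. f n) = (\<Sum>n<N. f (Suc n))"
proof -
  have "(\<Sum>\<^sub>\<infinity>n\<in>{1..}. f n) = (\<Sum>\<^sub>\<infinity>n\<in>{1..N}. f n)"
    using assms by (intro infsum_cong_neutral) auto
  also have "\<dots> = (\<Sum>n=1..N. f n)" by simp
  also have "\<dots> = (\<Sum>n<N. f (Suc n))" by (simp add: sum.atLeast1_atMost_eq)
  finally show ?thesis .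
qed

theorem theorem2p1:
  fixes \<alpha> \<beta> :: real and u :: "nat \<Rightarrow> real"
  assumes "finitely_supported u" and "u 0 = 0"
  shows "(\<Sum>\<^sub>\<infinity>n\<in>{1..}. \<bar>u n - u (n - 1)\<bar>\<^sup>2 * real n powr \<alpha>)
       \<ge> (\<Sum>\<^sub>\<infinity>n\<in>{1..}. hardy_weight \<alpha> \<beta> n * \<bar>u n\<bar>\<^sup>2)"
proof -
  obtain N where "\<forall>n\<in>{n. u n \<noteq> 0}. n < N"
    using assms(1) unfolding finitely_supported_def finite_nat_set_iff_bounded by blast
  then have vanish: "u n = 0" if "n \<ge> N" for n
    using that by force
  define l where
    "l n = real n powr \<alpha> * (1 - (1 - 1 / real n) powr \<beta>) * (u n)\<^sup>2" for n
  define r where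
    "r n = real (Suc n) powr \<alpha> * (1 - (1 + 1 / real n) powr \<beta>) * (u n)\<^sup>2" for n
  have "hardy_weight \<alpha> \<beta> (Suc n) * \<bar>u (Suc n)\<bar>\<^sup>2 = l (Suc n) + r (Suc n)" for n
    unfolding l_def r_def by (subst hardy_weight_eq_edge_shares) (simp_all only: distrib_right power2_abs)
  then have "(\<Sum>\<^sub>\<infinity>n\<in>{1..}. hardy_weight \<alpha> \<beta> n * \<bar>u n\<bar>\<^sup>2)
      = (\<Sum>n<N. l (Suc n)) + (\<Sum>n<N. r (Suc n))"
    using vanish by (subst infsum_from_one_eq_sum[of N]) (simp_all add: sum.distrib)
  also have "(\<Sum>n<N. r (Suc n)) = (\<Sum>n<N. r n)"
  proof -
    have "r 0 = 0" "r N = 0"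
      using assms(2) vanish[of N] by (simp_all add: r_def)
    then show ?thesis
      using sum.lessThan_Suc_shift[of r N] sum.lessThan_Suc[of r N] by simp
  qed
  also have "(\<Sum>n<N. l (Suc n)) + (\<Sum>n<N. r n)
      \<le> (\<Sum>n<N. (u (Suc n) - u n)\<^sup>2 * real (Suc n) powr \<alpha>)"
    unfolding sum.distrib[symmetric] l_def r_def
    by (intro sum_mono edge_energy_ge_shares assms(2))
  also have "\<dots> = (\<Sum>\<^sub>\<infinity>n\<in>{1..}. \<bar>u n - u (n - 1)\<bar>\<^sup>2 * real n powr \<alpha>)"
    using vanish by (subst infsum_from_one_eq_sum[of N]) simp_all
  finally show ?thesis .
qed

end
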